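(* Let $k\ge 1$, let $W_1^{\mathfrak{S}_k}$ be the algebra of $\mathfrak{S}_k$-invariant elements of the Weyl algebra $W_1$ in $z_1,\dots,z_k$, and let $\delta=\prod_{1\le i<j\le k}(z_i-z_j)$. Let $\mathcal{I}=\{P\in W_1^{\mathfrak{S}_k} : P(\delta)=0\}$ be the annihilator of $\delta$ in $W_1^{\mathfrak{S}_k}$. Then $\mathcal{I}$ is a maximal left ideal of $W_1^{\mathfrak{S}_k}$; that is, the left $W_1^{\mathfrak{S}_k}$-module $W_1^{\mathfrak{S}_k}/\mathcal{I}$ is simple.
   Context: $W_1=\mathbb{C}\langle z_1,\dots,z_k,\partial/\partial z_1,\dots,\partial/\partial z_k\rangle$ acts naturally on $\mathbb{C}[z_1,\dots,z_k]$, and $P(\delta)$ denotes the result of applying $P$ to the polynomial $\delta$. The symmetric group $\mathfrak{S}_k$ acts on $W_1$ by permuting simultaneously the $z_j$ and the $\partial/\partial z_j$. *)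

theory Defs
  imports
    Complex_Main
    "HOL-Library.Poly_Mapping"
    "HOL-Combinatorics.Permutations"
    "HOL-Algebra.QuotRing"
    "HOL-Algebra.Module"
    "HOL-Algebra.Generated_Rings"
begin

section \<open>Polynomials in finitely many variables\<close>

text \<open>
  The variables are indexed by a type \<open>'n\<close>; the intended instances are finite linear orders,
  i.e. copies of \<open>{1, \<dots>, k}\<close> with \<open>k = CARD('n) \<ge> 1\<close>.  A polynomial maps
  exponent vectors to coefficients.
\<close>

type_synonym 'n cpoly = "('n \<Rightarrow>\<^sub>0 nat) \<Rightarrow>\<^sub>0 complex"

definition Const :: "complex \<Rightarrow> 'n cpoly"
  where "Const c = Poly_Mapping.single 0 c"

definition Var :: "'n \<Rightarrow> 'n cpoly"
  where "Var i = Poly_Mapping.single (Poly_Mapping.single i 1) 1"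

text \<open>
  In the next definition the exponent \<open>m - single i 1\<close> is truncated when \<open>z\<^sub>i\<close> does not
  occur in \<open>m\<close>, but then the coefficient vanishes.
\<close>

definition partial :: "'n \<Rightarrow> 'n cpoly \<Rightarrow> 'n cpoly"
  where "partial i p = (\<Sum>m\<in>Poly_Mapping.keys p.
    Poly_Mapping.single (m - Poly_Mapping.single i 1)
      (of_nat (Poly_Mapping.lookup m i) * Poly_Mapping.lookup p m))"

text \<open>
  \<open>permute_poly \<sigma>\<close> substitutes \<open>z\<^bsub>\<sigma> i\<^esub>\<close> for \<open>z\<^sub>i\<close>: the coefficient of the
  exponent vector \<open>m\<close> in \<open>permute_poly \<sigma> p\<close> is that of \<open>m \<circ> \<sigma>\<close> in \<open>p\<close>.
  It is meaningful only for bijective \<open>\<sigma>\<close>.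
\<close>

definition permute_poly :: "('n \<Rightarrow> 'n) \<Rightarrow> 'n cpoly \<Rightarrow> 'n cpoly"
  where "permute_poly \<sigma> p = Poly_Mapping.map_key (Poly_Mapping.map_key \<sigma>) p"

definition vandermonde :: "'n::{finite,linorder} cpoly"
  where "vandermonde = (\<Prod>(i, j)\<in>{(i, j). i < j}. Var i - Var j)"


section \<open>The Weyl algebra and its invariants\<close>

text \<open>The ring of \<open>\<complex>\<close>-linear endomorphisms of the polynomial ring.\<close>

definition poly_End :: "('n cpoly \<Rightarrow> 'n cpoly) ring"
  where "poly_End =
    \<lparr>carrier = {T. (\<forall>p q. T (p + q) = T p + T q) \<and> (\<forall>c p. T (Const c * p) = Const c * T p)},
     mult = (\<circ>), one = id, zero = (\<lambda>_. 0), add = (\<lambda>S T p. S p + T p)\<rparr>"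

text \<open>
  The Weyl algebra is the algebra of polynomial differential operators: the \<open>\<complex>\<close>-subalgebra
  generated by the multiplications by the variables and by the partial derivatives.  Including the
  scalars among the generators makes the generated subring a \<open>\<complex>\<close>-subalgebra.
\<close>

definition weyl_generators :: "('n cpoly \<Rightarrow> 'n cpoly) set"
  where "weyl_generators =
    range (\<lambda>c p. Const c * p) \<union> range (\<lambda>i p. Var i * p) \<union> range partial"

definition weyl_algebra :: "('n cpoly \<Rightarrow> 'n cpoly) ring"
  where "weyl_algebra = poly_End\<lparr>carrier := generate_ring poly_End weyl_generators\<rparr>"

text \<open>
  Permuting simultaneously the \<open>z\<^sub>j\<close> and the \<open>\<partial>/\<partial>z\<^sub>j\<close> is, on operators, conjugation by
  the permutation of the variables; see \<open>weyl_act_Var\<close>, \<open>weyl_act_partial\<close> and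
  \<open>weyl_act_hom\<close> below.
\<close>

definition weyl_act :: "('n \<Rightarrow> 'n) \<Rightarrow> ('n cpoly \<Rightarrow> 'n cpoly) \<Rightarrow> ('n cpoly \<Rightarrow> 'n cpoly)"
  where "weyl_act \<sigma> P = permute_poly \<sigma> \<circ> P \<circ> permute_poly (inv_into UNIV \<sigma>)"

definition weyl_invariants :: "('n::finite cpoly \<Rightarrow> 'n cpoly) ring"
  where "weyl_invariants = weyl_algebra\<lparr>carrier :=
    {P \<in> carrier weyl_algebra. \<forall>\<sigma>. \<sigma> permutes UNIV \<longrightarrow> weyl_act \<sigma> P = P}\<rparr>"

definition vandermonde_annihilator :: "('n::{finite,linorder} cpoly \<Rightarrow> 'n cpoly) set"
  where "vandermonde_annihilator = {P \<in> carrier weyl_invariants. P vandermonde = 0}"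


section \<open>Left ideals and left modules over a noncommutative ring\<close>

locale left_ideal = additive_subgroup I R + ring R for I and R (structure) +
  assumes left_closed: "\<lbrakk>a \<in> I; x \<in> carrier R\<rbrakk> \<Longrightarrow> x \<otimes> a \<in> I"

locale maximal_left_ideal = left_ideal +
  assumes not_carrier: "carrier R \<noteq> I"
    and maximal: "\<lbrakk>left_ideal J R; I \<subseteq> J; J \<subseteq> carrier R\<rbrakk> \<Longrightarrow> J = I \<or> J = carrier R"

text \<open>The library's locale \<open>module\<close> requires a commutative ring of scalars.\<close>

locale left_module = R?: ring R + M?: abelian_group M
  for R :: "('a, 'r) ring_scheme" (structure) and M :: "('a, 'b, 'm) module_scheme" (structure) +
  assumes smult_closed:
      "\<lbrakk>a \<in> carrier R; x \<in> carrier M\<rbrakk> \<Longrightarrow> a \<odot>\<^bsub>M\<^esub> x \<in> carrier M"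
    and smult_l_distr:
      "\<lbrakk>a \<in> carrier R; b \<in> carrier R; x \<in> carrier M\<rbrakk> \<Longrightarrow>
      (a \<oplus> b) \<odot>\<^bsub>M\<^esub> x = a \<odot>\<^bsub>M\<^esub> x \<oplus>\<^bsub>M\<^esub> b \<odot>\<^bsub>M\<^esub> x"
    and smult_r_distr:
      "\<lbrakk>a \<in> carrier R; x \<in> carrier M; y \<in> carrier M\<rbrakk> \<Longrightarrow>
      a \<odot>\<^bsub>M\<^esub> (x \<oplus>\<^bsub>M\<^esub> y) = a \<odot>\<^bsub>M\<^esub> x \<oplus>\<^bsub>M\<^esub> a \<odot>\<^bsub>M\<^esub> y"
    and smult_assoc:
      "\<lbrakk>a \<in> carrier R; b \<in> carrier R; x \<in> carrier M\<rbrakk> \<Longrightarrow>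
      (a \<otimes> b) \<odot>\<^bsub>M\<^esub> x = a \<odot>\<^bsub>M\<^esub> (b \<odot>\<^bsub>M\<^esub> x)"
    and smult_one: "x \<in> carrier M \<Longrightarrow> \<one> \<odot>\<^bsub>M\<^esub> x = x"

locale simple_left_module = left_module +
  assumes nonzero: "carrier M \<noteq> {\<zero>\<^bsub>M\<^esub>}"
    and simple: "submodule N R M \<Longrightarrow> N = {\<zero>\<^bsub>M\<^esub>} \<or> N = carrier M"

text \<open>
  The left module \<open>R/I\<close>.  As for \<open>rcoset_mult\<close>, the scalar product is a union over
  representatives, all of which contribute the same coset.  The fields \<open>mult\<close> and \<open>one\<close>
  of the record are not part of the module structure.
\<close>

definition left_quotient :: "('a, 'b) ring_scheme \<Rightarrow> 'a set \<Rightarrow> ('a, 'a set) module"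
  where "left_quotient R I =
    \<lparr>carrier = a_rcosets\<^bsub>R\<^esub> I, mult = undefined, one = undefined, zero = I, add = set_add R,
     smult = (\<lambda>r X. \<Union>x\<in>X. I +>\<^bsub>R\<^esub> (r \<otimes>\<^bsub>R\<^esub> x))\<rparr>"


section \<open>Basic facts\<close>

lemma poly_eq_sum_single:
  "(p :: 'n cpoly) = (\<Sum>m\<in>Poly_Mapping.keys p. Poly_Mapping.single m (Poly_Mapping.lookup p m))"
  by (rule poly_mapping_eqI)
     (auto simp: lookup_sum lookup_single when_def sum.delta' in_keys_iff)

lemma partial_superset:
  assumes "finite A" "Poly_Mapping.keys p \<subseteq> A"
  shows "partial i p = (\<Sum>m\<in>A. Poly_Mapping.single (m - Poly_Mapping.single i 1)
      (of_nat (Poly_Mapping.lookup m i) * Poly_Mapping.lookup p m))"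
  unfolding partial_def
  using assms by (intro sum.mono_neutral_left) (auto simp: in_keys_iff)

lemma partial_add: "partial i (p + q) = partial i p + partial i q"
proof -
  let ?A = "Poly_Mapping.keys p \<union> Poly_Mapping.keys q"
  have "Poly_Mapping.keys (p + q) \<subseteq> ?A" by (rule Poly_Mapping.keys_add)
  then show ?thesis
    by (simp add: partial_superset[of ?A] lookup_add distrib_left single_add sum.distrib)
qed

lemma partial_zero [simp]: "partial i 0 = 0"
  by (simp add: partial_def)

lemma partial_single:
  "partial i (Poly_Mapping.single m c) =
    Poly_Mapping.single (m - Poly_Mapping.single i 1) (of_nat (Poly_Mapping.lookup m i) * c)"
  by (simp add: partial_superset[of "{m}"])

lemma partial_sum: "partial i (sum f A) = (\<Sum>a\<in>A. partial i (f a))"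
  by (induction A rule: infinite_finite_induct) (auto simp: partial_add)

lemma additive_eqI:
  fixes S T :: "'n cpoly \<Rightarrow> 'n cpoly"
  assumes S: "\<And>p q. S (p + q) = S p + S q" and T: "\<And>p q. T (p + q) = T p + T q"
    and eq: "\<And>m c. S (Poly_Mapping.single m c) = T (Poly_Mapping.single m c)"
  shows "S = T"
proof
  fix p
  have S0: "S 0 = 0" and T0: "T 0 = 0" using S[of 0 0] T[of 0 0] by auto
  have Ss: "S (sum f A) = (\<Sum>a\<in>A. S (f a))" for f :: "_ \<Rightarrow> 'n cpoly" and A :: "('n \<Rightarrow>\<^sub>0 nat) set"
    by (induction A rule: infinite_finite_induct) (auto simp: S S0)
  have Ts: "T (sum f A) = (\<Sum>a\<in>A. T (f a))" for f :: "_ \<Rightarrow> 'n cpoly" and A :: "('n \<Rightarrow>\<^sub>0 nat) set"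
    by (induction A rule: infinite_finite_induct) (auto simp: T T0)
  show "S p = T p"
    by (subst (1 2) poly_eq_sum_single) (simp add: Ss Ts eq)
qed

lemma partial_Const_mult: "partial i (Const c * p) = Const c * partial i p"
proof -
  have "(\<lambda>p. partial i (Const c * p)) = (\<lambda>p. Const c * partial i p)"
    by (rule additive_eqI)
       (auto simp: partial_add distrib_left partial_single Const_def mult_single algebra_simps)
  then show ?thesis by meson
qed

text \<open>The canonical commutation relations.\<close>

lemma partial_Var_mult: "partial i (Var j * p) = Var j * partial i p + (if i = j then p else 0)"
proof -
  have exps: "Poly_Mapping.single j 1 + m - Poly_Mapping.single i 1
      = Poly_Mapping.single j 1 + (m - Poly_Mapping.single i (1::nat))"
    if "i \<noteq> j \<or> Poly_Mapping.lookup m i \<noteq> 0" for m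
    using that by (intro poly_mapping_eqI) (auto simp: lookup_add lookup_minus lookup_single when_def)
  have "(\<lambda>p. partial i (Var j * p)) = (\<lambda>p. Var j * partial i p + (if i = j then p else 0))"
  proof (rule additive_eqI)
    fix m :: "'a \<Rightarrow>\<^sub>0 nat" and c
    show "partial i (Var j * Poly_Mapping.single m c) =
      Var j * partial i (Poly_Mapping.single m c) + (if i = j then Poly_Mapping.single m c else 0)"
    proof (cases "i \<noteq> j \<or> Poly_Mapping.lookup m i \<noteq> 0")
      case True
      then show ?thesis using exps[OF True]
        by (auto simp: Var_def mult_single partial_single lookup_add lookup_single when_def
            single_add[symmetric] algebra_simps)
    next
      case False
      then show ?thesis
        by (auto simp: Var_def mult_single partial_single lookup_add)
    qed
  qed (auto simp: partial_add algebra_simps)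
  then show ?thesis by meson
qed

lemma partial_commute: "partial i (partial j p) = partial j (partial i p)"
proof -
  have "partial i \<circ> partial j = partial j \<circ> partial i"
    by (rule additive_eqI)
       (auto simp: partial_add partial_single lookup_minus lookup_single when_def algebra_simps
         diff_diff_eq add.commute)
  then show ?thesis by (meson comp_eq_dest)
qed

lemma inj_map_key:
  assumes "bij (\<sigma> :: 'n \<Rightarrow> 'n)"
  shows "inj (Poly_Mapping.map_key \<sigma> :: ('n \<Rightarrow>\<^sub>0 nat) \<Rightarrow> _)"
proof (rule injI)
  fix m m' :: "'n \<Rightarrow>\<^sub>0 nat"
  assume eq: "Poly_Mapping.map_key \<sigma> m = Poly_Mapping.map_key \<sigma> m'"
  show "m = m'"
  proof (rule poly_mapping_eqI)
    fix k
    from assms obtain l where "k = \<sigma> l" by (meson bij_pointE)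
    moreover have "Poly_Mapping.lookup (Poly_Mapping.map_key \<sigma> m) l
        = Poly_Mapping.lookup (Poly_Mapping.map_key \<sigma> m') l"
      by (simp add: eq)
    ultimately show "Poly_Mapping.lookup m k = Poly_Mapping.lookup m' k"
      using assms by (simp add: map_key.rep_eq bij_is_inj)
  qed
qed

lemma lookup_permute_poly:
  assumes "bij \<sigma>"
  shows "Poly_Mapping.lookup (permute_poly \<sigma> p) m
    = Poly_Mapping.lookup p (Poly_Mapping.map_key \<sigma> m)"
  using inj_map_key[OF assms] by (simp add: permute_poly_def map_key.rep_eq)

lemma permute_poly_add: "bij \<sigma> \<Longrightarrow> permute_poly \<sigma> (p + q) = permute_poly \<sigma> p + permute_poly \<sigma> q"
  by (rule poly_mapping_eqI) (simp add: lookup_permute_poly lookup_add)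

lemma permute_poly_inv [simp]:
  assumes "bij \<sigma>"
  shows "permute_poly \<sigma> (permute_poly (inv_into UNIV \<sigma>) p) = p" "permute_poly (inv_into UNIV \<sigma>) (permute_poly \<sigma> p) = p"
  using assms
  by (auto intro!: poly_mapping_eqI simp: lookup_permute_poly bij_imp_bij_inv map_key_compose
      bij_is_inj bij_is_surj surj_iff[THEN iffD1] inj_iff[THEN iffD1] id_def map_key_id)

lemma permute_poly_single:
  assumes "bij \<sigma>"
  shows "permute_poly \<sigma> (Poly_Mapping.single m c)
    = Poly_Mapping.single (Poly_Mapping.map_key (inv_into UNIV \<sigma>) m) c"
proof -
  have "m = Poly_Mapping.map_key \<sigma> (Poly_Mapping.map_key (inv_into UNIV \<sigma>) m)"
    using assms by (simp add: map_key_compose bij_imp_bij_inv bij_is_inj inj_iff[THEN iffD1]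
        id_def map_key_id)
  then show ?thesis
    using map_key_single[OF inj_map_key[OF assms]] unfolding permute_poly_def by metis
qed

lemma permute_poly_mult:
  assumes "bij \<sigma>"
  shows "permute_poly \<sigma> (p * q) = permute_poly \<sigma> p * permute_poly \<sigma> q"
proof -
  have inv: "inj (inv_into UNIV \<sigma>)" using assms by (simp add: bij_imp_bij_inv bij_is_inj)
  have "(\<lambda>p. permute_poly \<sigma> (p * q)) = (\<lambda>p. permute_poly \<sigma> p * permute_poly \<sigma> q)"
  proof (rule additive_eqI)
    fix m c
    have "(\<lambda>q. permute_poly \<sigma> (Poly_Mapping.single m c * q))
      = (\<lambda>q. permute_poly \<sigma> (Poly_Mapping.single m c) * permute_poly \<sigma> q)"
      by (rule additive_eqI)
         (auto simp: permute_poly_add assms distrib_left mult_single permute_poly_single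
            map_key_plus inv)
    then show "permute_poly \<sigma> (Poly_Mapping.single m c * q)
      = permute_poly \<sigma> (Poly_Mapping.single m c) * permute_poly \<sigma> q"
      by meson
  qed (auto simp: permute_poly_add assms distrib_right)
  then show ?thesis by meson
qed

lemma map_key_inv_single:
  assumes "bij \<sigma>"
  shows "Poly_Mapping.map_key (inv_into UNIV \<sigma>) (Poly_Mapping.single i (c::nat)) = Poly_Mapping.single (\<sigma> i) c"
  using map_key_single[of "inv_into UNIV \<sigma>" "\<sigma> i" c] assms
  by (simp add: bij_imp_bij_inv bij_is_inj)

lemma permute_poly_Const [simp]: "bij \<sigma> \<Longrightarrow> permute_poly \<sigma> (Const c) = Const c"
  by (simp add: Const_def permute_poly_single bij_imp_bij_inv bij_is_inj)

lemma permute_poly_Var [simp]: "bij \<sigma> \<Longrightarrow> permute_poly \<sigma> (Var i) = Var (\<sigma> i)"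
  by (simp add: Var_def permute_poly_single map_key_inv_single)

lemma permute_poly_partial:
  assumes "bij \<sigma>"
  shows "permute_poly \<sigma> (partial i p) = partial (\<sigma> i) (permute_poly \<sigma> p)"
proof -
  have inv: "inj (inv_into UNIV \<sigma>)" using assms by (simp add: bij_imp_bij_inv bij_is_inj)
  have minus: "Poly_Mapping.map_key (inv_into UNIV \<sigma>) (m - n)
      = Poly_Mapping.map_key (inv_into UNIV \<sigma>) m - Poly_Mapping.map_key (inv_into UNIV \<sigma>) n" for m n :: "'a \<Rightarrow>\<^sub>0 nat"
    by (rule poly_mapping_eqI) (simp add: map_key.rep_eq inv lookup_minus)
  have "permute_poly \<sigma> \<circ> partial i = partial (\<sigma> i) \<circ> permute_poly \<sigma>"
    by (rule additive_eqI)
       (auto simp: permute_poly_add partial_add assms partial_single permute_poly_single minus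
          map_key_inv_single map_key.rep_eq inv bij_is_inj)
  then show ?thesis by (meson comp_eq_dest)
qed

lemma weyl_act_Const: "bij \<sigma> \<Longrightarrow> weyl_act \<sigma> (\<lambda>p. Const c * p) = (\<lambda>p. Const c * p)"
  by (auto simp: weyl_act_def permute_poly_mult)

lemma weyl_act_Var: "bij \<sigma> \<Longrightarrow> weyl_act \<sigma> (\<lambda>p. Var i * p) = (\<lambda>p. Var (\<sigma> i) * p)"
  by (auto simp: weyl_act_def permute_poly_mult)

lemma weyl_act_partial: "bij \<sigma> \<Longrightarrow> weyl_act \<sigma> (partial i) = partial (\<sigma> i)"
  by (auto simp: weyl_act_def permute_poly_partial)

lemma ring_poly_End: "ring (poly_End :: ('n cpoly \<Rightarrow> 'n cpoly) ring)"
proof (rule ringI)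
  show "abelian_group (poly_End :: ('n cpoly \<Rightarrow> 'n cpoly) ring)"
  proof (rule abelian_groupI)
    fix T :: "'n cpoly \<Rightarrow> 'n cpoly" assume "T \<in> carrier poly_End"
    then show "\<exists>S\<in>carrier poly_End. S \<oplus>\<^bsub>poly_End\<^esub> T = \<zero>\<^bsub>poly_End\<^esub>"
      by (intro bexI[of _ "\<lambda>p. - T p"]) (auto simp: poly_End_def)
  qed (auto simp: poly_End_def algebra_simps)
  show "monoid (poly_End :: ('n cpoly \<Rightarrow> 'n cpoly) ring)"
    by (rule monoidI) (auto simp: poly_End_def)
qed (auto simp: poly_End_def)

lemma weyl_generators_closed: "weyl_generators \<subseteq> carrier poly_End"
  by (auto simp: weyl_generators_def poly_End_def distrib_left partial_add partial_Const_mult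
      mult.left_commute)

lemma ring_weyl_algebra: "ring weyl_algebra"
  unfolding weyl_algebra_def
  by (rule ring.generate_ring_is_ring[OF ring_poly_End weyl_generators_closed])

lemma weyl_algebra_sel [simp]:
  "mult weyl_algebra = (\<circ>)" "one weyl_algebra = id" "zero weyl_algebra = (\<lambda>_. 0)"
  "add weyl_algebra = (\<lambda>S T p. S p + T p)"
  by (simp_all add: weyl_algebra_def poly_End_def)

lemma poly_End_uminus:
  assumes "T \<in> carrier poly_End"
  shows "\<ominus>\<^bsub>poly_End\<^esub> T = (\<lambda>p. - T p)"
proof -
  interpret ring poly_End by (rule ring_poly_End)
  have "(\<lambda>p. - T p) \<oplus>\<^bsub>poly_End\<^esub> T = \<zero>\<^bsub>poly_End\<^esub>" "(\<lambda>p. - T p) \<in> carrier poly_End"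
    using assms by (auto simp: poly_End_def)
  then show ?thesis using assms minus_equality by blast
qed

lemma weyl_act_closed:
  assumes \<sigma>: "bij \<sigma>" and "P \<in> carrier weyl_algebra"
  shows "weyl_act \<sigma> P \<in> carrier weyl_algebra"
proof -
  let ?W = "generate_ring poly_End weyl_generators"
  note in_End = ring.generate_ring_in_carrier[OF ring_poly_End weyl_generators_closed]
  have "P \<in> ?W" using assms(2) by (simp add: weyl_algebra_def)
  then have "weyl_act \<sigma> P \<in> ?W"
  proof (induction rule: generate_ring.induct)
    case one
    have "weyl_act \<sigma> \<one>\<^bsub>poly_End\<^esub> = \<one>\<^bsub>poly_End\<^esub>"
      using \<sigma> by (auto simp: weyl_act_def poly_End_def)
    then show ?case by (simp add: generate_ring.one)
  next
    case (incl h)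
    then have "weyl_act \<sigma> h \<in> weyl_generators"
      by (auto simp: weyl_generators_def weyl_act_Const weyl_act_Var weyl_act_partial \<sigma>)
    then show ?case by (rule generate_ring.incl)
  next
    case (a_inv h)
    have "permute_poly \<sigma> (- p) = - permute_poly \<sigma> p" for p
      by (rule poly_mapping_eqI) (simp add: lookup_permute_poly \<sigma>)
    then have "weyl_act \<sigma> (\<ominus>\<^bsub>poly_End\<^esub> h) = \<ominus>\<^bsub>poly_End\<^esub> (weyl_act \<sigma> h)"
      using poly_End_uminus[OF in_End[OF a_inv.hyps]] poly_End_uminus[OF in_End[OF a_inv.IH]]
      by (simp add: weyl_act_def fun_eq_iff o_def)
    then show ?case using a_inv by (simp add: generate_ring.a_inv)
  next
    case (eng_add h1 h2)
    have "weyl_act \<sigma> (h1 \<oplus>\<^bsub>poly_End\<^esub> h2) = weyl_act \<sigma> h1 \<oplus>\<^bsub>poly_End\<^esub> weyl_act \<sigma> h2"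
      by (auto simp: weyl_act_def poly_End_def permute_poly_add \<sigma>)
    then show ?case using eng_add by (simp add: generate_ring.eng_add)
  next
    case (eng_mult h1 h2)
    have "weyl_act \<sigma> (h1 \<otimes>\<^bsub>poly_End\<^esub> h2) = weyl_act \<sigma> h1 \<otimes>\<^bsub>poly_End\<^esub> weyl_act \<sigma> h2"
      by (auto simp: weyl_act_def poly_End_def \<sigma>)
    then show ?case using eng_mult by (simp add: generate_ring.eng_mult)
  qed
  then show ?thesis by (simp add: weyl_algebra_def)
qed

lemma weyl_act_hom: "bij \<sigma> \<Longrightarrow> weyl_act \<sigma> \<in> ring_hom weyl_algebra weyl_algebra"
  by (rule ring_hom_memI, erule (1) weyl_act_closed) (auto simp: weyl_act_def permute_poly_add)

lemma ring_weyl_invariants: "ring weyl_invariants"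
proof -
  interpret W: ring weyl_algebra by (rule ring_weyl_algebra)
  have "subring {P \<in> carrier weyl_algebra. \<forall>\<sigma>. \<sigma> permutes UNIV \<longrightarrow> weyl_act \<sigma> P = P}
    (weyl_algebra :: ('a cpoly \<Rightarrow> 'a cpoly) ring)" (is "subring ?S _")
  proof (rule W.subringI)
    fix P :: "'a cpoly \<Rightarrow> 'a cpoly" assume P: "P \<in> ?S"
    have "weyl_act \<sigma> (\<ominus>\<^bsub>weyl_algebra\<^esub> P) = \<ominus>\<^bsub>weyl_algebra\<^esub> P" if "\<sigma> permutes UNIV" for \<sigma>
    proof -
      interpret h: ring_hom_ring weyl_algebra weyl_algebra "weyl_act \<sigma>"
        using that weyl_act_hom permutes_bij
        by (blast intro: ring_hom_ringI2 ring_weyl_algebra)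
      show ?thesis using P that by simp
    qed
    then show "\<ominus>\<^bsub>weyl_algebra\<^esub> P \<in> ?S" using P by simp
  next
    fix P Q :: "'a cpoly \<Rightarrow> 'a cpoly" assume PQ: "P \<in> ?S" "Q \<in> ?S"
    note hom = weyl_act_hom[OF permutes_bij]
    show "P \<otimes>\<^bsub>weyl_algebra\<^esub> Q \<in> ?S"
      using PQ ring_hom_mult[OF hom, of _ UNIV P Q] W.m_closed[of P Q] by simp
    show "P \<oplus>\<^bsub>weyl_algebra\<^esub> Q \<in> ?S"
      using PQ ring_hom_add[OF hom, of _ UNIV P Q] W.add.m_closed[of P Q] by simp
  next
    show "\<one>\<^bsub>weyl_algebra\<^esub> \<in> ?S"
      using ring_hom_one[OF weyl_act_hom[OF permutes_bij]] W.one_closed by auto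
  qed auto
  then show ?thesis
    unfolding weyl_invariants_def by (rule W.subring_is_ring)
qed

end

theory Submission
  imports Defs
begin

text \<open>
  Every polynomial operator \<open>D\<close> can be averaged over the symmetric group, and if \<open>D\<close> maps \<open>P(\<delta>)\<close>
  to \<open>\<delta>\<close> for an invariant \<open>P\<close> then so does its average, because \<open>\<delta>\<close> spans a one-dimensional
  representation.  When \<open>P(\<delta>) \<noteq> 0\<close> such a \<open>D\<close> exists: differentiate \<open>P(\<delta>)\<close> down to a nonzero
  constant, rescale, and multiply by \<open>\<delta>\<close>.  Hence every \<open>P \<notin> \<I>\<close> has an invariant \<open>Q\<close> with
  \<open>Q P - 1 \<in> \<I>\<close>, which is the maximality of \<open>\<I>\<close>.
\<close>

section \<open>Quotients by left ideals\<close>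

lemma (in left_ideal) abelian_subgroup: "abelian_subgroup I R"
  by (intro abelian_subgroupI3 additive_subgroup_axioms abelian_group_axioms)

lemma (in left_ideal) left_quotient_sel [simp]:
  "carrier (left_quotient R I) = a_rcosets I" "zero (left_quotient R I) = I"
  "add (left_quotient R I) = set_add R"
  by (simp_all add: left_quotient_def)

text \<open>A representative \<open>y = i \<oplus> x\<close> with \<open>i\<close> in
  \<open>I\<close> gives \<open>a \<otimes> y = a \<otimes> i \<oplus> a \<otimes> x\<close>, and
  \<open>a \<otimes> i\<close> lies in \<open>I\<close> by \<open>left_closed\<close>. So all
  members of the union in \<open>left_quotient\<close> coincide, and the union is nonempty because
  \<open>x\<close> itself is a representative.\<close>

lemma (in left_ideal) smult_coset:
  assumes "a \<in> carrier R" "x \<in> carrier R"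
  shows "a \<odot>\<^bsub>left_quotient R I\<^esub> (I +> x) = I +> (a \<otimes> x)"
proof -
  interpret S: abelian_subgroup I R by (rule abelian_subgroup)
  have "I +> (a \<otimes> y) = I +> (a \<otimes> x)" if "y \<in> I +> x" for y
  proof -
    from that obtain i where i: "i \<in> I" "y = i \<oplus> x" by (auto simp: a_r_coset_def')
    have "a \<otimes> y \<in> I +> (a \<otimes> x)"
      using i assms left_closed[OF i(1) assms(1)] by (auto simp: a_r_coset_def' r_distr)
    then show ?thesis using S.a_repr_independence' assms by auto
  qed
  moreover have "x \<in> I +> x" using assms S.a_rcos_self by blast
  ultimately have "(\<Union>y\<in>I +> x. I +> (a \<otimes> y)) = I +> (a \<otimes> x)" by blast
  then show ?thesis by (simp add: left_quotient_def)
qed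

lemma (in left_ideal) left_quotient_cases:
  assumes "X \<in> carrier (left_quotient R I)"
  obtains x where "x \<in> carrier R" "X = I +> x"
  using assms by (auto simp: A_RCOSETS_def')

lemma (in left_ideal) left_module_left_quotient: "left_module R (left_quotient R I)"
proof -
  interpret S: abelian_subgroup I R by (rule abelian_subgroup)
  have coset: "I +> x \<in> carrier (left_quotient R I)" if "x \<in> carrier R" for x
    using that a_rcosetsI a_subset by simp
  show ?thesis
  proof (intro left_module.intro left_module_axioms.intro ring_axioms)
    show "abelian_group (left_quotient R I)"
    proof (rule abelian_groupI)
      fix X assume "X \<in> carrier (left_quotient R I)"
      then obtain x where x: "x \<in> carrier R" "X = I +> x" by (rule left_quotient_cases)
      then show "\<exists>Y\<in>carrier (left_quotient R I).
          Y \<oplus>\<^bsub>left_quotient R I\<^esub> X = \<zero>\<^bsub>left_quotient R I\<^esub>"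
        using a_subset by (intro bexI[of _ "I +> (\<ominus> x)"]) (auto simp: S.a_rcos_sum l_neg coset simp del: left_quotient_sel(1))
    next
      fix X Y assume "X \<in> carrier (left_quotient R I)" "Y \<in> carrier (left_quotient R I)"
      then show "X \<oplus>\<^bsub>left_quotient R I\<^esub> Y = Y \<oplus>\<^bsub>left_quotient R I\<^esub> X"
        by (elim left_quotient_cases) (simp add: S.a_rcos_sum a_comm)
    qed (simp_all add: S.a_setmult_closed S.a_subgroup_in_rcosets S.a_rcosets_assoc
        S.rcosets_add_eq)
  qed (auto elim!: left_quotient_cases
      simp: smult_coset coset S.a_rcos_sum l_distr r_distr m_assoc simp del: left_quotient_sel(1))
qed

text \<open>The half of the correspondence theorem that carries maximality of \<open>I\<close> over
  to simplicity of the quotient: submodules pull back along the projection.\<close>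

lemma (in left_ideal) left_ideal_submodule_preimage:
  assumes "submodule N R (left_quotient R I)"
  shows "left_ideal {x \<in> carrier R. I +> x \<in> N} R"
proof -
  interpret S: abelian_subgroup I R by (rule abelian_subgroup)
  interpret N: submodule N R "left_quotient R I" by (rule assms)
  let ?J = "{x \<in> carrier R. I +> x \<in> N}"
  have smult: "I +> (a \<otimes> x) \<in> N" if "a \<in> carrier R" "x \<in> ?J" for a x
    using that N.smult_closed[of a "I +> x"] by (simp add: smult_coset)
  have "I +> (x \<oplus> y) \<in> N" if "x \<in> ?J" "y \<in> ?J" for x y
    using that N.m_closed[of "I +> x" "I +> y"] by (simp add: S.a_rcos_sum)
  \<comment> \<open>Negation is the scalar action of \<open>\<ominus> \<one>\<close>.\<close>
  moreover have "I +> (\<ominus> x) \<in> N" if "x \<in> ?J" for x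
    using that smult[of "\<ominus> \<one>" x] by (simp add: l_minus)
  moreover have "I +> \<zero> \<in> N"
    using N.one_closed a_subset by simp
  ultimately have "subgroup ?J (add_monoid R)"
    by (intro add.subgroupI) (auto simp: a_inv_def[symmetric])
  then show ?thesis
    using smult
    by (intro left_ideal.intro left_ideal_axioms.intro ring_axioms additive_subgroup.intro) auto
qed

lemma (in maximal_left_ideal) simple_left_module_left_quotient:
  "simple_left_module R (left_quotient R I)"
proof (intro simple_left_module.intro simple_left_module_axioms.intro left_module_left_quotient)
  interpret S: abelian_subgroup I R by (rule abelian_subgroup)
  obtain x where x: "x \<in> carrier R" "x \<notin> I"
    using not_carrier a_subset by blast
  then have "I +> x \<noteq> I" using S.a_rcos_self by blast
  then show "carrier (left_quotient R I) \<noteq> {\<zero>\<^bsub>left_quotient R I\<^esub>}"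
    using x a_rcosetsI[OF a_subset x(1)] by auto
next
  interpret S: abelian_subgroup I R by (rule abelian_subgroup)
  fix N assume N: "submodule N R (left_quotient R I)"
  interpret N: submodule N R "left_quotient R I" by (rule N)
  let ?J = "{x \<in> carrier R. I +> x \<in> N}"
  have IN: "I \<in> N" using N.one_closed by simp
  have coset: "\<exists>x\<in>?J. X = I +> x" if "X \<in> N" for X
  proof -
    have "X \<in> carrier (left_quotient R I)" using that N.subset by auto
    then show ?thesis using that by (elim left_quotient_cases) blast
  qed
  have "?J = I \<or> ?J = carrier R"
    \<comment> \<open>The preimage contains \<open>I\<close> because each of its elements has coset
      \<open>I\<close>, the zero of the quotient, which lies in \<open>N\<close>.\<close>
    using IN by (intro maximal left_ideal_submodule_preimage N) (auto simp: S.a_rcos_const)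
  then show "N = {\<zero>\<^bsub>left_quotient R I\<^esub>} \<or> N = carrier (left_quotient R I)"
  proof
    assume "?J = I"
    then have "N = {I}" using IN coset S.a_rcos_const by blast
    then show ?thesis by simp
  next
    assume "?J = carrier R"
    then have "N = carrier (left_quotient R I)"
      using N.subset by (auto elim!: left_quotient_cases simp del: left_quotient_sel)
    then show ?thesis by simp
  qed
qed

text \<open>If every element outside \<open>I\<close> is left invertible modulo \<open>I\<close>, a
  left ideal \<open>J\<close> above \<open>I\<close> with a further element \<open>x\<close>
  contains both \<open>y \<otimes> x\<close> and \<open>y \<otimes> x \<ominus> \<one>\<close>,
  hence their difference \<open>\<one>\<close>.\<close>

lemma (in left_ideal) maximal_left_idealI:
  assumes one: "\<one> \<notin> I"
    and inverse: "\<And>x. x \<in> carrier R \<Longrightarrow> x \<notin> I \<Longrightarrow> \<exists>y\<in>carrier R. y \<otimes> x \<ominus> \<one> \<in> I"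
  shows "maximal_left_ideal I R"
proof (intro maximal_left_ideal.intro maximal_left_ideal_axioms.intro left_ideal_axioms)
  show "carrier R \<noteq> I" using one by auto
next
  fix J assume J: "left_ideal J R" "I \<subseteq> J" "J \<subseteq> carrier R"
  interpret J: left_ideal J R by (rule J)
  show "J = I \<or> J = carrier R"
  proof (rule disjCI)
    assume "J \<noteq> carrier R"
    have "x \<in> I" if "x \<in> J" for x
    proof (rule ccontr)
      assume "x \<notin> I"
      with that J(3) have "\<exists>y\<in>carrier R. y \<otimes> x \<ominus> \<one> \<in> I" by (intro inverse) auto
      with J(2) obtain y where y: "y \<in> carrier R" "y \<otimes> x \<ominus> \<one> \<in> J" by (auto dest: subsetD)
      have "y \<otimes> x \<in> J" using that y(1) by (rule J.left_closed)
      then have "y \<otimes> x \<oplus> \<ominus> (y \<otimes> x \<ominus> \<one>) \<in> J" using y(2) by (intro J.a_closed J.a_inv_closed)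
      moreover have "y \<otimes> x \<oplus> \<ominus> (y \<otimes> x \<ominus> \<one>) = \<one>"
      proof -
        have "y \<otimes> x \<in> carrier R" using y(1) that J(3) by auto
        then show ?thesis by (simp add: minus_eq minus_add r_neg2)
      qed
      ultimately have "\<one> \<in> J" by simp
      then have "z \<in> J" if "z \<in> carrier R" for z using J.left_closed[of \<one> z] that by simp
      then have "J = carrier R" using J(3) by (intro equalityI) auto
      with \<open>J \<noteq> carrier R\<close> show False ..
    qed
    then show "J = I" using J(2) by blast
  qed
qed


section \<open>Closure properties of the Weyl algebra\<close>

lemma weyl_generator_closed: "P \<in> weyl_generators \<Longrightarrow> P \<in> carrier weyl_algebra"
  by (simp add: weyl_algebra_def generate_ring.incl)

lemma weyl_Const: "(\<lambda>p. Const c * p) \<in> carrier weyl_algebra"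
  and weyl_Var: "(\<lambda>p. Var i * p) \<in> carrier weyl_algebra"
  and weyl_partial: "partial i \<in> carrier weyl_algebra"
  by (auto intro!: weyl_generator_closed simp: weyl_generators_def)

lemma weyl_compose:
  "P \<in> carrier weyl_algebra \<Longrightarrow> Q \<in> carrier weyl_algebra \<Longrightarrow> (\<lambda>p. P (Q p)) \<in> carrier weyl_algebra"
  using monoid.m_closed[OF ring.is_monoid[OF ring_weyl_algebra], of P Q] by (simp add: o_def)

lemma weyl_add:
  "P \<in> carrier weyl_algebra \<Longrightarrow> Q \<in> carrier weyl_algebra \<Longrightarrow> (\<lambda>p. P p + Q p) \<in> carrier weyl_algebra"
  using ring.ring_simprules(1)[OF ring_weyl_algebra, of P Q] by simp

lemma weyl_sum:
  assumes "\<And>a. a \<in> A \<Longrightarrow> F a \<in> carrier weyl_algebra"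
  shows "(\<lambda>p. \<Sum>a\<in>A. F a p) \<in> carrier weyl_algebra"
proof -
  have 0: "(\<lambda>_. 0) \<in> carrier weyl_algebra"
    using ring.ring_simprules(2)[OF ring_weyl_algebra] by simp
  show ?thesis
    using assms by (induction A rule: infinite_finite_induct) (auto simp: 0 intro: weyl_add)
qed

lemma weyl_mult_prod:
  fixes f :: "'a \<Rightarrow> 'n cpoly"
  assumes "\<And>a. a \<in> A \<Longrightarrow> (\<lambda>p. f a * p) \<in> carrier weyl_algebra"
  shows "(\<lambda>p. prod f A * p) \<in> carrier weyl_algebra"
proof -
  have "(*) 1 = (id :: 'n cpoly \<Rightarrow> 'n cpoly)" by auto
  then have 1: "(*) 1 \<in> carrier (weyl_algebra :: ('n cpoly \<Rightarrow> 'n cpoly) ring)"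
    using ring.ring_simprules(6)[OF ring_weyl_algebra] by simp
  show ?thesis
    using assms
  proof (induction A rule: infinite_finite_induct)
    case (insert a A)
    then show ?case
      using weyl_compose[of "(*) (f a)" "(*) (prod f A)"] by (simp flip: mult.assoc)
  qed (simp_all add: 1)
qed

lemma Const_zero [simp]: "Const 0 = 0"
  and Const_one [simp]: "Const 1 = 1"
  and Const_add: "Const (a + b) = Const a + Const b"
  and Const_mult: "Const (a * b) = Const a * Const b"
  by (simp_all add: Const_def single_add mult_single)

lemma Const_minus_one_mult: "Const (- 1) * p = - (p :: 'n cpoly)"
proof -
  have "Const (- 1) = - (1 :: 'n cpoly)"
    unfolding Const_def by (simp flip: single_one add: single_uminus)
  then show ?thesis by simp
qed

text \<open>Ensures that the last step of the construction, going from 1 to \<delta>, stays inside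
  the Weyl algebra.\<close>

lemma weyl_mult_vandermonde:
  "(\<lambda>p. vandermonde * p) \<in> carrier (weyl_algebra :: ('n::{finite,linorder} cpoly \<Rightarrow> 'n cpoly) ring)"
proof -
  have "(\<lambda>p. (Var i - Var j) * p) \<in> carrier weyl_algebra" for i j :: 'n
    using weyl_add[OF weyl_Var[of i] weyl_compose[OF weyl_Const[of "- 1"] weyl_Var[of j]]]
    by (simp add: Const_minus_one_mult left_diff_distrib)
  then show ?thesis
    unfolding vandermonde_def by (intro weyl_mult_prod) auto
qed

lemma weyl_linear:
  assumes "P \<in> carrier weyl_algebra"
  shows "P (p + q) = P p + P q" "P (Const c * p) = Const c * P p"
proof -
  have "P \<in> carrier poly_End"
    using assms ring.generate_ring_in_carrier[OF ring_poly_End weyl_generators_closed]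
    by (simp add: weyl_algebra_def)
  then show "P (p + q) = P p + P q" "P (Const c * p) = Const c * P p"
    by (simp_all add: poly_End_def)
qed


section \<open>Lowering a polynomial to a constant\<close>

text \<open>By additivity a single monomial \<open>n\<close> suffices. The truncated exponent
  \<open>n - ?e\<close> equals \<open>m\<close> exactly when \<open>n = m + ?e\<close>, unless
  \<open>z\<^sub>i\<close> is absent from \<open>n\<close>; in that case both sides vanish.\<close>

lemma lookup_partial:
  "Poly_Mapping.lookup (partial i p) m
    = of_nat (Poly_Mapping.lookup m i + 1) * Poly_Mapping.lookup p (m + Poly_Mapping.single i 1)"
proof -
  let ?e = "Poly_Mapping.single i (1::nat)"
  have single: "Poly_Mapping.lookup (partial i (Poly_Mapping.single n c)) m
      = of_nat (Poly_Mapping.lookup m i + 1) * Poly_Mapping.lookup (Poly_Mapping.single n c) (m + ?e)"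
    for n c
  proof (cases "Poly_Mapping.lookup n i = 0")
    case True
    then have "n \<noteq> m + ?e" by (auto simp: lookup_add)
    with True show ?thesis by (simp add: partial_single lookup_single)
  next
    case False
    have "n - ?e = m \<longleftrightarrow> n = m + ?e"
      using False by (auto simp: poly_mapping_eq_iff fun_eq_iff lookup_add lookup_minus lookup_single when_def)
    then show ?thesis by (auto simp: partial_single lookup_single lookup_add when_def)
  qed
  show ?thesis
    by (subst (1 2) poly_eq_sum_single) (simp add: partial_sum lookup_sum single sum_distrib_left)
qed

text \<open>A nonzero exponent vector \<open>m\<close> involves some variable \<open>i\<close>, and
  the coefficient of \<open>partial i p\<close> at \<open>m - ?e\<close> is a positive integer times
  that of \<open>p\<close> at \<open>m\<close>. Characteristic zero forces the latter to
  vanish.\<close>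

lemma partials_zero_imp_Const:
  assumes "\<And>i. partial i p = 0"
  shows "p = Const (Poly_Mapping.lookup p 0)"
proof (rule poly_mapping_eqI)
  fix m
  show "Poly_Mapping.lookup p m = Poly_Mapping.lookup (Const (Poly_Mapping.lookup p 0)) m"
  proof (cases "m = 0")
    case False
    then obtain i where i: "Poly_Mapping.lookup m i \<noteq> 0" by (auto simp: poly_mapping_eq_iff fun_eq_iff)
    let ?e = "Poly_Mapping.single i (1::nat)"
    have "m - ?e + ?e = m"
      using i by (auto simp: poly_mapping_eq_iff fun_eq_iff lookup_add lookup_minus lookup_single when_def)
    then have "Poly_Mapping.lookup p m = 0"
      using lookup_partial[of i p "m - ?e"] assms[of i] by (simp flip: of_nat_Suc)
    then show ?thesis using False by (simp add: Const_def lookup_single)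
  qed (simp add: Const_def)
qed

lemma exists_weyl_to_one:
  fixes p :: "'n::finite cpoly"
  assumes "p \<noteq> 0"
  shows "\<exists>D\<in>carrier weyl_algebra. D p = 1"
proof -
  let ?deg = "\<lambda>m. \<Sum>i\<in>UNIV. Poly_Mapping.lookup m (i::'n)"
  \<comment> \<open>Induction on a strict bound \<open>n\<close> for the total degree; at
    \<open>n = 0\<close> no monomial is left, contradicting \<open>p \<noteq> 0\<close>.\<close>
  have *: "\<exists>D\<in>carrier weyl_algebra. D p = 1"
    if "p \<noteq> 0" "\<And>m. m \<in> Poly_Mapping.keys p \<Longrightarrow> ?deg m < n" for n and p :: "'n cpoly"
    using that
  proof (induction n arbitrary: p)
    case 0
    then have "Poly_Mapping.keys p \<noteq> {}" by simp
    then show ?case using 0(2) by blast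
  next
    case (Suc n)
    show ?case
    proof (cases "\<forall>i. partial i p = 0")
      case True
      then have p: "p = Const (Poly_Mapping.lookup p 0)" by (blast intro: partials_zero_imp_Const)
      let ?c = "Poly_Mapping.lookup p 0"
      have "?c \<noteq> 0" using p Suc.prems(1) by auto
      then have "Const (1 / ?c) * p = 1" by (subst (2) p) (simp flip: Const_mult)
      then show ?thesis using weyl_Const by blast
    next
      case False
      then obtain i where i: "partial i p \<noteq> 0" by blast
      have "?deg m < n" if "m \<in> Poly_Mapping.keys (partial i p)" for m
      proof -
        let ?e = "Poly_Mapping.single i (1::nat)"
        \<comment> \<open>Each monomial of the derivative comes from one of \<open>p\<close> whose
          degree is larger by one.\<close>
        have "m + ?e \<in> Poly_Mapping.keys p"
          using that by (auto simp: in_keys_iff lookup_partial)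
        then have "?deg (m + ?e) < Suc n" by (rule Suc.prems(2))
        then show ?thesis by (simp add: lookup_add sum.distrib lookup_single when_def)
      qed
      then obtain D where "D \<in> carrier weyl_algebra" "D (partial i p) = 1"
        using Suc.IH[OF i] by blast
      then show ?thesis by (intro bexI[OF _ weyl_compose[OF _ weyl_partial]])
    qed
  qed
  \<comment> \<open>The sum of the degrees of all monomials is a crude but sufficient initial
    bound.\<close>
  have "?deg m < Suc (sum ?deg (Poly_Mapping.keys p))"
    if "m \<in> Poly_Mapping.keys p" for m
    using member_le_sum[OF that, of ?deg] by (simp only: less_Suc_eq_le finite_keys zero_le simp_thms)
  then show ?thesis by (rule *[OF assms])
qed


section \<open>The Vandermonde polynomial\<close>

text \<open>The polynomial ring has no zero divisors, and distinct variables have distinct supports,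
  so no factor is zero.\<close>

lemma vandermonde_nonzero: "vandermonde \<noteq> (0 :: 'n::{finite,linorder} cpoly)"
proof -
  have "Var i \<noteq> (Var j :: 'n cpoly)" if "i < j" for i j
    using that by (auto simp: Var_def dest!: arg_cong[of _ _ Poly_Mapping.keys])
  then show ?thesis unfolding vandermonde_def by auto
qed

lemma permute_poly_prod:
  "bij \<sigma> \<Longrightarrow> permute_poly \<sigma> (prod f A) = (\<Prod>a\<in>A. permute_poly \<sigma> (f a))"
proof (induction A rule: infinite_finite_induct)
  case (insert a A)
  then show ?case by (simp add: permute_poly_mult)
qed (use permute_poly_Const[of \<sigma> 1] in simp_all)

lemma permute_poly_uminus: "bij \<sigma> \<Longrightarrow> permute_poly \<sigma> (- p) = - permute_poly \<sigma> p"
  by (rule poly_mapping_eqI) (simp add: lookup_permute_poly)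

lemma permute_poly_comp:
  assumes "bij \<sigma>" "bij \<tau>"
  shows "permute_poly \<sigma> (permute_poly \<tau> p) = permute_poly (\<sigma> \<circ> \<tau>) p"
  using assms
  by (intro poly_mapping_eqI)
     (simp add: lookup_permute_poly bij_comp map_key_compose bij_is_inj)

text \<open>The permutation moves the factors among themselves up to sign; the scalar is the product
  of these signs.\<close>

lemma permute_vandermonde:
  fixes \<sigma> :: "'n::{finite,linorder} \<Rightarrow> 'n"
  assumes \<sigma>: "bij \<sigma>"
  shows "\<exists>c. permute_poly \<sigma> vandermonde = Const c * vandermonde"
proof -
  let ?A = "{(i, j). i < (j::'n)}"
  \<comment> \<open>\<open>\<phi>\<close> applies \<open>\<sigma>\<close> to a pair and then sorts
    it; \<open>s\<close> is -1 exactly when sorting an increasing pair requires a swap.\<close>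
  define \<phi> where "\<phi> = (\<lambda>(i, j). if \<sigma> i < \<sigma> j then (\<sigma> i, \<sigma> j) else (\<sigma> j, \<sigma> i))"
  define s where "s = (\<lambda>(i, j). if \<sigma> i < \<sigma> j then 1 else - 1 :: complex)"
  have inj: "\<sigma> i = \<sigma> j \<longleftrightarrow> i = j" for i j
    using \<sigma> by (auto simp: bij_def inj_eq)
  have "inj_on \<phi> ?A"
    by (auto simp: inj_on_def \<phi>_def inj split: if_splits)
  moreover have "\<phi> ` ?A \<subseteq> ?A"
    by (auto simp: \<phi>_def inj not_less order.strict_iff_order split: if_splits)
  \<comment> \<open>An injective self-map of a finite set is bijective.\<close>
  ultimately have \<phi>: "bij_betw \<phi> ?A ?A"
    by (simp add: bij_betw_def endo_inj_surj)
  have Const_prod: "(\<Prod>a\<in>B. Const (f a)) = Const (prod f B)" for f and B :: "('n \<times> 'n) set"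
    by (induction B rule: infinite_finite_induct) (simp_all add: Const_mult)
  have diff: "permute_poly \<sigma> (Var i - Var j) = Var (\<sigma> i) - Var (\<sigma> j)" for i j
    using permute_poly_add[OF \<sigma>, of "Var i" "- Var j"] \<sigma> by (simp add: permute_poly_uminus)
  have "permute_poly \<sigma> vandermonde = (\<Prod>(i, j)\<in>?A. Var (\<sigma> i) - Var (\<sigma> j))"
    by (simp add: vandermonde_def permute_poly_prod \<sigma> diff case_prod_unfold)
  also have "\<dots> = (\<Prod>a\<in>?A. Const (s a) * (\<lambda>(i, j). Var i - Var j) (\<phi> a))"
    by (rule prod.cong) (auto simp: s_def \<phi>_def Const_minus_one_mult)
  also have "\<dots> = Const (prod s ?A) * vandermonde"
    using prod.reindex_bij_betw[OF \<phi>, of "\<lambda>(i, j). Var i - Var j"]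
    by (simp add: prod.distrib Const_prod vandermonde_def)
  finally show ?thesis by blast
qed


section \<open>Averaging over the symmetric group\<close>

text \<open>The Reynolds operator of the symmetric group on the Weyl algebra.\<close>

definition symmetrize :: "('n::finite cpoly \<Rightarrow> 'n cpoly) \<Rightarrow> 'n cpoly \<Rightarrow> 'n cpoly"
  where "symmetrize D p =
    Const (1 / of_nat (card {\<sigma>::'n \<Rightarrow> 'n. \<sigma> permutes UNIV})) * (\<Sum>\<sigma> | \<sigma> permutes UNIV. weyl_act \<sigma> D p)"

lemma weyl_invariants_sel [simp]:
  "mult weyl_invariants = (\<circ>)" "one weyl_invariants = id" "zero weyl_invariants = (\<lambda>_. 0)"
  "add weyl_invariants = (\<lambda>S T p. S p + T p)"
  by (simp_all add: weyl_invariants_def)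

lemma weyl_invariants_iff:
  "P \<in> carrier weyl_invariants
    \<longleftrightarrow> P \<in> carrier weyl_algebra \<and> (\<forall>\<sigma>. \<sigma> permutes UNIV \<longrightarrow> weyl_act \<sigma> P = P)"
  by (simp add: weyl_invariants_def)

text \<open>Invariance under conjugation, evaluated at \<open>permute_poly \<sigma> p\<close> so
  that the inner inverse permutation cancels.\<close>

lemma weyl_invariant_commutes:
  assumes "P \<in> carrier weyl_invariants" "\<sigma> permutes UNIV"
  shows "permute_poly \<sigma> (P p) = P (permute_poly \<sigma> p)"
proof -
  have "weyl_act \<sigma> P (permute_poly \<sigma> p) = P (permute_poly \<sigma> p)"
    using assms by (simp add: weyl_invariants_iff)
  then show ?thesis using permutes_bij[OF assms(2)] by (simp add: weyl_act_def)
qed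

lemma weyl_act_comp:
  assumes "bij \<sigma>" "bij \<tau>"
  shows "weyl_act \<sigma> (weyl_act \<tau> P) = weyl_act (\<sigma> \<circ> \<tau>) P"
  using assms
  by (simp add: weyl_act_def fun_eq_iff permute_poly_comp bij_imp_bij_inv o_inv_distrib)

lemma permute_poly_sum:
  assumes "bij \<sigma>"
  shows "permute_poly \<sigma> (sum f A) = (\<Sum>a\<in>A. permute_poly \<sigma> (f a))"
  using permute_poly_Const[of \<sigma> 0] assms
  by (induction A rule: infinite_finite_induct) (auto simp: permute_poly_add)

text \<open>Conjugation by \<open>\<tau>\<close> fixes the scalar factor and turns the summand of
  \<open>\<sigma>\<close> into that of \<open>\<tau> \<circ> \<sigma>\<close>; left translation only
  reorders the sum.\<close>

lemma symmetrize_invariant: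
  fixes D :: "'n::finite cpoly \<Rightarrow> 'n cpoly"
  assumes "D \<in> carrier weyl_algebra"
  shows "symmetrize D \<in> carrier weyl_invariants"
proof -
  let ?S = "{\<sigma>::'n \<Rightarrow> 'n. \<sigma> permutes UNIV}"
  have "symmetrize D \<in> carrier weyl_algebra"
    using assms unfolding symmetrize_def[abs_def]
    by (intro weyl_compose[OF weyl_Const] weyl_sum weyl_act_closed) (auto intro: permutes_bij)
  moreover have "weyl_act \<tau> (symmetrize D) = symmetrize D" if "\<tau> permutes UNIV" for \<tau>
  proof
    fix p
    have "weyl_act \<tau> (symmetrize D) p
        = Const (1 / of_nat (card ?S)) * (\<Sum>\<sigma>\<in>?S. weyl_act \<tau> (weyl_act \<sigma> D) p)"
      using permutes_bij[OF that]
      by (simp add: weyl_act_def[of \<tau>] symmetrize_def permute_poly_mult permute_poly_sum)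
    also have "(\<Sum>\<sigma>\<in>?S. weyl_act \<tau> (weyl_act \<sigma> D) p) = (\<Sum>\<sigma>\<in>?S. weyl_act (\<tau> \<circ> \<sigma>) D p)"
      using that by (intro sum.cong) (auto simp: weyl_act_comp permutes_bij)
    also have "\<dots> = (\<Sum>\<sigma>\<in>?S. weyl_act \<sigma> D p)"
      using setum_permutations_compose_left[OF that, of "\<lambda>\<sigma>. weyl_act \<sigma> D p"] by simp
    finally show "weyl_act \<tau> (symmetrize D) p = symmetrize D p"
      by (simp add: symmetrize_def[of D p])
  qed
  ultimately show ?thesis by (simp add: weyl_invariants_iff)
qed

text \<open>Every summand already sends P(\<delta>) to \<delta>. The inverse of
  \<open>\<sigma>\<close> multiplies \<delta> by some scalar \<open>c\<close>, hence also
  P(\<delta>), since \<open>P\<close> is linear and commutes with permutations. Then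
  \<open>D\<close> yields \<open>c\<close> times \<delta>, which is the image of \<delta> under the
  inverse, and \<open>\<sigma>\<close> takes it back to \<delta>.\<close>

lemma symmetrize_vandermonde:
  fixes D P :: "'n::{finite,linorder} cpoly \<Rightarrow> 'n cpoly"
  assumes D: "D \<in> carrier weyl_algebra" and P: "P \<in> carrier weyl_invariants"
    and DP: "D (P vandermonde) = vandermonde"
  shows "symmetrize D (P vandermonde) = vandermonde"
proof -
  let ?S = "{\<sigma>::'n \<Rightarrow> 'n. \<sigma> permutes UNIV}"
  have P': "P \<in> carrier weyl_algebra" using P by (simp add: weyl_invariants_iff)
  have "weyl_act \<sigma> D (P vandermonde) = vandermonde" if "\<sigma> permutes UNIV" for \<sigma>
  proof -
    have \<sigma>: "bij \<sigma>" "bij (inv_into UNIV \<sigma>)" using that permutes_bij bij_imp_bij_inv by blast+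
    obtain c where c: "permute_poly (inv_into UNIV \<sigma>) vandermonde = Const c * (vandermonde :: 'n cpoly)"
      using permute_vandermonde[OF \<sigma>(2)] by blast
    have "D (permute_poly (inv_into UNIV \<sigma>) (P vandermonde)) = Const c * vandermonde"
      by (simp add: weyl_invariant_commutes[OF P permutes_inv[OF that]] c weyl_linear(2)[OF P'] weyl_linear(2)[OF D] DP)
    also have "\<dots> = permute_poly (inv_into UNIV \<sigma>) vandermonde" by (simp add: c)
    finally show ?thesis using \<sigma>(1) by (simp add: weyl_act_def)
  qed
  then have "symmetrize D (P vandermonde)
      = Const (1 / of_nat (card ?S)) * (of_nat (card ?S) * vandermonde)"
    by (simp add: symmetrize_def)
  \<comment> \<open>Writes the number of permutations as a constant polynomial, so that it cancels
    against the normalizing factor.\<close>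
  moreover have "of_nat n = (Const (of_nat n) :: 'n cpoly)" for n
    by (induction n) (simp_all add: Const_add)
  moreover have "card ?S \<noteq> 0" by (simp add: card_permutations[OF refl])
  ultimately show ?thesis by (simp flip: mult.assoc Const_mult)
qed


section \<open>Maximality of the annihilator\<close>

text \<open>Closed under left multiplication because operators in the Weyl algebra are additive and
  so send 0 to 0.\<close>

lemma left_ideal_vandermonde_annihilator:
  "left_ideal (vandermonde_annihilator :: ('n::{finite,linorder} cpoly \<Rightarrow> 'n cpoly) set) weyl_invariants"
proof -
  interpret R: ring "weyl_invariants :: ('n cpoly \<Rightarrow> 'n cpoly) ring" by (rule ring_weyl_invariants)
  have zero: "P 0 = 0" if "P \<in> carrier weyl_invariants" for P :: "'n cpoly \<Rightarrow> 'n cpoly"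
    using that weyl_linear(1)[of P 0 0] by (simp add: weyl_invariants_iff)
  \<comment> \<open>The additive inverse of the ring is abstract; evaluating \<open>l_neg\<close> at
    \<open>p\<close> identifies it with pointwise negation.\<close>
  have uminus: "(\<ominus>\<^bsub>weyl_invariants\<^esub> P) p = - P p"
    if "P \<in> carrier weyl_invariants" for P :: "'n cpoly \<Rightarrow> 'n cpoly" and p
    using fun_cong[OF R.l_neg[OF that], of p] by (simp add: eq_neg_iff_add_eq_0)
  have "subgroup (vandermonde_annihilator :: ('n cpoly \<Rightarrow> 'n cpoly) set) (add_monoid weyl_invariants)"
    using R.zero_closed R.add.m_closed R.a_inv_closed
    by (intro R.add.subgroupI)
       (auto simp: vandermonde_annihilator_def uminus a_inv_def[symmetric])
  then show ?thesis
    using R.m_closed zero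
    by (intro left_ideal.intro left_ideal_axioms.intro R.ring_axioms additive_subgroup.intro)
       (auto simp: vandermonde_annihilator_def)
qed

theorem theorem2p3p1:
  shows "maximal_left_ideal
      (vandermonde_annihilator :: ('n::{finite,linorder} cpoly \<Rightarrow> 'n cpoly) set) weyl_invariants \<and>
    simple_left_module (weyl_invariants :: ('n cpoly \<Rightarrow> 'n cpoly) ring)
      (left_quotient weyl_invariants vandermonde_annihilator)"
proof -
  let ?I = "vandermonde_annihilator :: ('n cpoly \<Rightarrow> 'n cpoly) set"
  interpret R: ring "weyl_invariants :: ('n cpoly \<Rightarrow> 'n cpoly) ring" by (rule ring_weyl_invariants)
  have "maximal_left_ideal ?I weyl_invariants"
  proof (rule left_ideal.maximal_left_idealI[OF left_ideal_vandermonde_annihilator])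
    show "\<one>\<^bsub>weyl_invariants\<^esub> \<notin> ?I"
      by (simp add: vandermonde_annihilator_def vandermonde_nonzero)
  next
    fix P :: "'n cpoly \<Rightarrow> 'n cpoly"
    assume P: "P \<in> carrier weyl_invariants" "P \<notin> ?I"
    then have "P vandermonde \<noteq> 0" by (simp add: vandermonde_annihilator_def)
    then obtain E where E: "E \<in> carrier weyl_algebra" "E (P vandermonde) = 1"
      using exists_weyl_to_one by blast
    \<comment> \<open>Multiplication by \<delta> after \<open>E\<close> sends P(\<delta>) to
      \<delta>, but it may fail to be invariant; averaging repairs this and keeps the value.\<close>
    let ?Q = "symmetrize (\<lambda>p. vandermonde * E p)"
    have D: "(\<lambda>p. vandermonde * E p) \<in> carrier weyl_algebra"
      using weyl_compose[OF weyl_mult_vandermonde E(1)] .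
    have Q: "?Q \<in> carrier weyl_invariants" "?Q (P vandermonde) = vandermonde"
      using symmetrize_invariant[OF D] symmetrize_vandermonde[OF D P(1)] E(2) by auto
    let ?T = "?Q \<otimes>\<^bsub>weyl_invariants\<^esub> P \<ominus>\<^bsub>weyl_invariants\<^esub> \<one>\<^bsub>weyl_invariants\<^esub>"
    have QP: "?Q \<otimes>\<^bsub>weyl_invariants\<^esub> P \<in> carrier weyl_invariants" using Q(1) P(1) by (rule R.m_closed)
    \<comment> \<open>Evaluated at \<delta>, this sum reads T(\<delta>) + \<delta> = Q(P(\<delta>))
      = \<delta>, so T(\<delta>) = 0 without unfolding the ring subtraction.\<close>
    have "?T \<oplus>\<^bsub>weyl_invariants\<^esub> \<one>\<^bsub>weyl_invariants\<^esub> = ?Q \<otimes>\<^bsub>weyl_invariants\<^esub> P"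
      using QP by (simp only: R.minus_eq R.a_assoc R.one_closed R.a_inv_closed R.l_neg R.r_zero)
    from fun_cong[OF this, of vandermonde] have "?T vandermonde = 0"
      using Q(2) by simp
    moreover have "?T \<in> carrier weyl_invariants" using QP R.one_closed by (rule R.minus_closed)
    ultimately have "?T \<in> ?I" by (simp only: vandermonde_annihilator_def mem_Collect_eq simp_thms)
    with Q(1) show "\<exists>Q\<in>carrier weyl_invariants.
        Q \<otimes>\<^bsub>weyl_invariants\<^esub> P \<ominus>\<^bsub>weyl_invariants\<^esub> \<one>\<^bsub>weyl_invariants\<^esub> \<in> ?I" by blast
  qed
  then show ?thesis using maximal_left_ideal.simple_left_module_left_quotient by blast
qed

end
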